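(* Let $I$ be a finite set, and for $\alpha\in I$, let $C_\alpha$ and $Z_\alpha$ be $\mathbb{Z}_+$-valued random variables. Let $\mathbf{w}=(w(\alpha))_{\alpha\in I}$ (with values in $\mathbb{R}^d$, $d\ge1$) and $\mathbf{u}=(u(\alpha))_{\alpha\in I}$ (with values in $\mathbb{R}$) be deterministic weight functions on $I$, let $T=\sum_{\alpha\in I}w(\alpha)Z_\alpha$ and $U=\sum_{\alpha\in I}u(\alpha)C_\alpha$. Let $\mathbb{P}$ and $t$ be such that, under $\mathbb{P}$, the $Z_\alpha$ are mutually independent, $\mathbb{P}(T=t)>0$, and $\mathbf{C}_I\stackrel{d}{=}(\mathbf{Z}_I\mid T=t)$. Let $\theta>0$ be such that $\mathbb{E}\,\theta^{\mathbf{u}\cdot\mathbf{Z}_I}<\infty$, and let $\mathbb{P}_\theta$ be given by $d\mathbb{P}_\theta/d\mathbb{P}=\theta^U/\mathbb{E}\theta^U$ on the sigma-field generated by $\mathbf{C}_I$ and by $d\mathbb{P}_\theta/d\mathbb{P}=\theta^{\mathbf{u}\cdot\mathbf{Z}_I}/\mathbb{E}\theta^{\mathbf{u}\cdot\mathbf{Z}_I}$ on the sigma-field generated by $\mathbf{Z}_I$. For $B\subset I$ write $U_B=\sum_{\alpha\in B}u(\alpha)Z_\alpha$ and $R_B=\sum_{\alpha\in B}w(\alpha)Z_\alpha$, so that $U_I=\mathbf{u}\cdot\mathbf{Z}_I$. Then for $B\subset I$ $$d_{TV}\bigl(\mathcal{L}_\theta(\mathbf{C}_B),\mathcal{L}_\theta(\mathbf{Z}_B)\bigr)=d_{TV}\bigl(\mathcal{L}_\theta(R_B\mid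 T=t),\mathcal{L}_\theta(R_B)\bigr).$$ Moreover, if $u_*\in\mathbb{R}$ is such that $\mathbb{P}(U=u_* )>0$, then under the further conditioning on $U=u_*$, for $B\subset I$, $$d_{TV}\bigl(\mathcal{L}_1(\mathbf{C}_B\mid U=u_* ),\mathcal{L}_\theta(\mathbf{Z}_B)\bigr)=d_{TV}\bigl(\mathcal{L}_\theta((U_B,R_B)\mid U_I=u_*,T=t),\ \mathcal{L}_\theta((U_B,R_B))\bigr).$$
   Context: $\mathbb{Z}_+=\{0,1,2,\ldots\}$; for $B\subset I$, $\mathbf{C}_B=(C_\alpha)_{\alpha\in B}$, $\mathbf{Z}_B=(Z_\alpha)_{\alpha\in B}$, and $\mathbf{u}\cdot\mathbf{Z}_I=\sum_{\alpha\in I}u(\alpha)Z_\alpha$. $\mathbb{E}$ is expectation under $\mathbb{P}$. $\mathbb{P}_\theta$ specifies, separately, a law for $\mathbf{C}_I$ and a law for $\mathbf{Z}_I$; $\mathcal{L}_\theta(\cdot)$ denotes the distribution under $\mathbb{P}_\theta$, $\mathcal{L}_\theta(\cdot\mid E)$ the conditional distribution under $\mathbb{P}_\theta$ given the event $E$, and $\mathcal{L}_1$ corresponds to $\theta=1$, i.e. to $\mathbb{P}_1=\mathbb{P}$. For probability distributions $\mu,\nu$ on a countable set $S$, $d_{TV}(\mu,\nu)=\frac12\sum_{s\in S}|\mu(s)-\nu(s)|$. $\stackrel{d}{=}$ denotes equality in distribution. *)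

theory Defs
  imports "HOL-Probability.Probability"
begin

definition weight :: "'i set \<Rightarrow> ('i \<Rightarrow> 'v::real_vector) \<Rightarrow> ('i \<Rightarrow> nat) \<Rightarrow> 'v"
  where "weight B w n = (\<Sum>\<alpha>\<in>B. real (n \<alpha>) *\<^sub>R w \<alpha>)"

definition subfamily :: "'i set \<Rightarrow> ('i \<Rightarrow> 'a \<Rightarrow> nat) \<Rightarrow> 'a \<Rightarrow> ('i \<Rightarrow> nat)"
  where "subfamily B X \<omega> = (\<lambda>\<alpha>\<in>B. X \<alpha> \<omega>)"

definition configs :: "'i set \<Rightarrow> ('i \<Rightarrow> nat) set"
  where "configs B = B \<rightarrow>\<^sub>E UNIV"

text \<open>
  The law of a random variable \<open>X\<close> is a measure on all subsets of a set \<open>S\<close>, which has to be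
  countable and to contain all values of \<open>X\<close>; otherwise \<open>X\<close> need not be measurable.
\<close>

definition law :: "'s set \<Rightarrow> 'a measure \<Rightarrow> ('a \<Rightarrow> 's) \<Rightarrow> 's measure"
  where "law S P X = distr P (count_space S) X"

definition cond_law :: "'s set \<Rightarrow> 'a measure \<Rightarrow> ('a \<Rightarrow> 's) \<Rightarrow> 'a set \<Rightarrow> 's measure"
  where "cond_law S P X E = law S (uniform_measure P E) X"

definition dTV :: "'s set \<Rightarrow> 's measure \<Rightarrow> 's measure \<Rightarrow> real"
  where "dTV S \<mu> \<nu> = 1 / 2 * (\<Sum>\<^sub>\<infinity>s\<in>S. \<bar>measure \<mu> {s} - measure \<nu> {s}\<bar>)"

definition generated_field :: "'a measure \<Rightarrow> 'i set \<Rightarrow> ('i \<Rightarrow> 'a \<Rightarrow> nat) \<Rightarrow> 'a measure"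
  where "generated_field P I X =
    vimage_algebra (space P) (subfamily I X) (\<Pi>\<^sub>M \<alpha>\<in>I. count_space UNIV)"

text \<open>
  The tilted measure lives only on the sigma-field generated by the family \<open>X\<close>.  Tilting with
  respect to two families hence gives two unrelated measures, and no joint law of the two
  families is specified.
\<close>

definition tilted ::
    "'a measure \<Rightarrow> 'i set \<Rightarrow> ('i \<Rightarrow> real) \<Rightarrow> ('i \<Rightarrow> 'a \<Rightarrow> nat) \<Rightarrow> real \<Rightarrow> 'a measure"
  where "tilted P I u X \<theta> =
    density (restr_to_subalg P (generated_field P I X))
      (\<lambda>\<omega>. ennreal (\<theta> powr weight I u (\<lambda>\<alpha>. X \<alpha> \<omega>) /
                     (\<integral>\<omega>'. \<theta> powr weight I u (\<lambda>\<alpha>. X \<alpha> \<omega>') \<partial>P)))"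

lemma tilted_1:
  assumes "prob_space P"
  shows "tilted P I u X 1 = restr_to_subalg P (generated_field P I X)"
proof -
  interpret prob_space P by fact
  show ?thesis by (simp add: tilted_def prob_space density_1)
qed

lemma space_tilted [simp]: "space (tilted P I u X \<theta>) = space P"
  by (simp add: tilted_def space_restr_to_subalg)

lemma countable_configs: "finite B \<Longrightarrow> countable (configs B)"
  unfolding configs_def by (rule countable_PiE) auto

lemma countable_range_restrict:
  assumes "finite B" "\<And>n. f (restrict n B) = f n"
  shows "countable (range (f :: ('i \<Rightarrow> nat) \<Rightarrow> 'b))"
proof (rule countable_subset)
  show "range f \<subseteq> f ` configs B"
  proof
    fix y assume "y \<in> range f"
    then obtain n where "y = f (restrict n B)" using assms(2) by auto
    then show "y \<in> f ` configs B" by (auto simp: configs_def)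
  qed
qed (simp add: countable_configs assms(1))

lemma weight_restrict [simp]: "weight B w (restrict n B) = weight B w n"
  by (simp add: weight_def)

lemma countable_range_weight: "finite B \<Longrightarrow> countable (range (weight B w))"
  by (rule countable_range_restrict) auto

lemma countable_range_weight_pair:
  "finite B \<Longrightarrow> countable (range (\<lambda>n. (weight B u n, weight B w n)))"
  by (rule countable_range_restrict) auto

end

theory Submission
  imports Defs
begin

text \<open>
  Independence survives tilting, so under the tilted law of \<open>Z\<close> the blocks \<open>B\<close> and \<open>I - B\<close> are
  independent.  For an additive statistic \<open>f\<close>, conditioning on \<open>f I = s\<close> therefore multiplies the
  weight of a configuration \<open>b\<close> of \<open>B\<close> by a factor \<open>h (f B b)\<close> depending on \<open>b\<close> only through
  \<open>f B b\<close>; that is, \<open>f B\<close> is a sufficient statistic for the pair of laws, and passing to the law of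
  a sufficient statistic preserves total variation distance.  Tilting commutes with conditioning,
  so the tilted law of \<open>C\<close> is the tilted law of \<open>Z\<close> given \<open>T = t\<close>; and since the tilting density is
  constant on \<open>U = u\<^sub>0\<close>, conditioning further on this event removes the tilt.  The two claims
  are the cases \<open>f = w\<close> and \<open>f = (u, w)\<close>.
\<close>

section \<open>Sums of point masses and total variation distance under a statistic\<close>

lemma has_sum_measure_singletons:
  assumes "finite_measure M" "countable A" "Pow A \<subseteq> sets M"
  shows "((\<lambda>x. measure M {x}) has_sum measure M A) A"
proof -
  interpret finite_measure M by fact
  let ?f = "\<lambda>x. measure M {x}"
  have "emeasure M A = (\<integral>\<^sup>+x. emeasure M {x} \<partial>count_space A)"
    using assms(2,3) by (intro emeasure_countable_singleton) auto
  then have eq: "(\<integral>\<^sup>+x. ennreal (?f x) \<partial>count_space A) = ennreal (measure M A)"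
    by (simp only: emeasure_eq_measure)
  then have "integrable (count_space A) ?f"
    by (intro integrableI_bounded) auto
  then have abs: "Infinite_Set_Sum.abs_summable_on ?f A"
    by (simp add: Infinite_Set_Sum.abs_summable_on_def)
  have "?f summable_on A"
    using abs_summable_summable[OF iffD2[OF abs_summable_equivalent abs]] .
  moreover have "infsum ?f A = measure M A"
    unfolding infsetsum_infsum[OF abs, symmetric]
    by (subst infsetsum_conv_nn_integral) (simp_all add: eq)
  ultimately show ?thesis
    using has_sum_infsum by metis
qed

text \<open>On the fibre of \<open>f\<close> over \<open>r\<close> the difference of the point
  masses is \<open>h r - 1\<close> times the mass under \<open>\<mu>\<close>. It has one sign on the
  whole fibre, so taking absolute values before or after summing over the fibre gives the same
  result.\<close>

lemma dTV_law_statistic: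
  fixes f :: "'s \<Rightarrow> 'r"
  assumes "finite_measure \<mu>" "finite_measure \<nu>" and S: "countable S"
    and sets: "sets \<mu> = Pow S" "sets \<nu> = Pow S"
    and f: "f ` S = R"
    and h: "\<And>x. x \<in> S \<Longrightarrow> measure \<nu> {x} = measure \<mu> {x} * h (f x)"
  shows "dTV S \<nu> \<mu> = dTV R (law R \<nu> f) (law R \<mu> f)"
proof -
  interpret \<mu>: finite_measure \<mu> by fact
  interpret \<nu>: finite_measure \<nu> by fact
  have sp: "space \<mu> = S" "space \<nu> = S"
    using sets sets_eq_imp_space_eq[of _ "count_space S"] by auto
  have f1: "f \<in> measurable \<mu> (count_space R)" "f \<in> measurable \<nu> (count_space R)"
    using f sets sp by (auto simp: measurable_def)
  define F where "F r = {x \<in> S. f x = r}" for r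
  have law: "measure (law R \<mu> f) {r} = measure \<mu> (F r)" "measure (law R \<nu> f) {r} = measure \<nu> (F r)"
    if "r \<in> R" for r
    using that f1 by (auto simp: law_def measure_distr F_def sp intro!: arg_cong[where f="measure _"])
  have hs: "((\<lambda>x. measure \<mu> {x}) has_sum measure \<mu> A) A" "((\<lambda>x. measure \<nu> {x}) has_sum measure \<nu> A) A"
    if "A \<subseteq> S" for A
    using that sets S by (auto intro!: has_sum_measure_singletons assms(1,2) countable_subset[OF that])
  have F: "F r \<subseteq> S" for r by (auto simp: F_def)
  have \<nu>F: "measure \<nu> (F r) = measure \<mu> (F r) * h r" for r
  proof (rule has_sum_unique[OF hs(2)[OF F]])
    have "((\<lambda>x. measure \<mu> {x} * h r) has_sum measure \<mu> (F r) * h r) (F r)"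
      by (intro has_sum_cmult_left hs F)
    then show "((\<lambda>x. measure \<nu> {x}) has_sum measure \<mu> (F r) * h r) (F r)"
      by (subst has_sum_cong) (auto simp: F_def h)
  qed
  let ?d = "\<lambda>x. \<bar>measure \<nu> {x} - measure \<mu> {x}\<bar>"
  have fibre: "infsum ?d (F r) = \<bar>measure \<nu> (F r) - measure \<mu> (F r)\<bar>" for r
  proof -
    have "infsum ?d (F r) = (\<Sum>\<^sub>\<infinity>x\<in>F r. \<bar>h r - 1\<bar> * measure \<mu> {x})"
    proof (intro infsum_cong)
      fix x assume "x \<in> F r"
      then have "measure \<nu> {x} - measure \<mu> {x} = (h r - 1) * measure \<mu> {x}"
        by (auto simp: F_def h algebra_simps)
      then show "?d x = \<bar>h r - 1\<bar> * measure \<mu> {x}" by (simp add: abs_mult)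
    qed
    also have "\<dots> = \<bar>h r - 1\<bar> * measure \<mu> (F r)"
      using hs(1)[OF F] by (simp add: infsum_cmult_right' infsumI)
    also have "\<dots> = \<bar>(h r - 1) * measure \<mu> (F r)\<bar>"
      by (simp add: abs_mult)
    also have "\<dots> = \<bar>measure \<nu> (F r) - measure \<mu> (F r)\<bar>"
      by (simp add: \<nu>F algebra_simps)
    finally show ?thesis .
  qed
  \<comment> \<open>Summability, by comparison with the sum of the two masses, justifies regrouping
    the sum over \<open>S\<close> into fibres.\<close>
  have "?d summable_on S"
  proof (rule summable_on_comparison_test)
    show "(\<lambda>x. measure \<nu> {x} + measure \<mu> {x}) summable_on S"
      using hs[OF order_refl] by (intro summable_on_add) (auto simp: summable_on_def)
  qed (auto intro: order_trans[OF abs_triangle_ineq4])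
  \<comment> \<open>The fibres partition \<open>S\<close>, so a sum over \<open>S\<close> is a
    double sum over \<open>r\<close> in \<open>R\<close> and over the fibre of
    \<open>r\<close>.\<close>
  have bij: "bij_betw snd (Sigma R F) S"
    using f by (auto simp: bij_betw_def inj_on_def F_def image_def)
  have "infsum ?d S = infsum (\<lambda>z. ?d (snd z)) (Sigma R F)"
    by (rule infsum_reindex_bij_betw[OF bij, symmetric])
  also have "\<dots> = (\<Sum>\<^sub>\<infinity>r\<in>R. infsum ?d (F r))"
    using infsum_Sigma_banach[of "\<lambda>z. ?d (snd z)" R F] \<open>?d summable_on S\<close>
      summable_on_reindex_bij_betw[OF bij, of ?d] by simp
  also have "\<dots> = (\<Sum>\<^sub>\<infinity>r\<in>R. \<bar>measure (law R \<nu> f) {r} - measure (law R \<mu> f) {r}\<bar>)"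
    by (intro infsum_cong) (simp add: fibre law)
  finally show ?thesis by (simp add: dTV_def)
qed

section \<open>Product-form measures conditioned on an additive statistic\<close>

lemma weight_split:
  "finite I \<Longrightarrow> B \<subseteq> I \<Longrightarrow> weight I v n = weight B v n + weight (I - B) v n"
  by (simp add: weight_def sum.subset_diff add.commute)

text \<open>A configuration of \<open>I\<close> is a pair of configurations of \<open>B\<close> and
  \<open>I - B\<close>, and the product splits accordingly. Since \<open>Q\<close> looks only at the
  second component, the remaining sum does not involve \<open>b\<close>.\<close>

lemma measure_fibre:
  assumes "finite I" "B \<subseteq> I" "finite_measure M" and sets: "sets M = Pow (configs I)"
    and prod: "\<And>n. n \<in> configs I \<Longrightarrow> measure M {n} = c * (\<Prod>\<alpha>\<in>I. g \<alpha> (n \<alpha>))"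
    and b: "b \<in> configs B"
  shows "measure M {n \<in> configs I. restrict n B = b \<and> Q (restrict n (I - B))} =
    c * (\<Prod>\<alpha>\<in>B. g \<alpha> (b \<alpha>)) * (\<Sum>\<^sub>\<infinity>d\<in>{d \<in> configs (I - B). Q d}. \<Prod>\<alpha>\<in>I - B. g \<alpha> (d \<alpha>))"
    (is "measure M ?A = _ * infsum ?G ?D")
proof -
  have "measure M ?A = (\<Sum>\<^sub>\<infinity>n\<in>?A. measure M {n})"
    using sets assms(1,3)
    by (intro infsumI[symmetric] has_sum_measure_singletons)
      (auto intro: countable_subset[OF _ countable_configs])
  also have "\<dots> = (\<Sum>\<^sub>\<infinity>d\<in>?D. c * (\<Prod>\<alpha>\<in>B. g \<alpha> (b \<alpha>)) * ?G d)"
  \<comment> \<open>With the part on \<open>B\<close> fixed to \<open>b\<close>, a configuration is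
    determined by its part \<open>d\<close> on \<open>I - B\<close>; \<open>merge\<close> glues the
    two together again.\<close>
  proof (rule infsum_reindex_bij_witness[where j="\<lambda>n. restrict n (I - B)" and i="\<lambda>d. merge B (I - B) (b, d)"])
    fix n assume n: "n \<in> ?A"
    then have "b = restrict n B" by simp
    with n show "merge B (I - B) (b, restrict n (I - B)) = n"
      using assms(2) by (auto simp: merge_def fun_eq_iff configs_def PiE_def extensional_def)
    show "restrict n (I - B) \<in> ?D"
      using n by (auto simp: configs_def)
    have "(\<Prod>\<alpha>\<in>I. g \<alpha> (n \<alpha>)) = (\<Prod>\<alpha>\<in>B. g \<alpha> (n \<alpha>)) * (\<Prod>\<alpha>\<in>I - B. g \<alpha> (n \<alpha>))"
      using assms(1,2) by (simp add: prod.subset_diff mult.commute)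
    moreover have "(\<Prod>\<alpha>\<in>B. g \<alpha> (n \<alpha>)) = (\<Prod>\<alpha>\<in>B. g \<alpha> (b \<alpha>))"
      using n by (intro prod.cong) auto
    ultimately show "c * (\<Prod>\<alpha>\<in>B. g \<alpha> (b \<alpha>)) * ?G (restrict n (I - B)) = measure M {n}"
      using prod[of n] n by simp
  next
    fix d assume d: "d \<in> ?D"
    then show *: "restrict (merge B (I - B) (b, d)) (I - B) = d"
      by (auto simp: configs_def)
    have "restrict (merge B (I - B) (b, d)) B = b" using b by (auto simp: configs_def)
    moreover have "merge B (I - B) (b, d) \<in> configs I"
      using assms(2) by (auto simp: configs_def PiE_def extensional_def merge_def)
    ultimately show "merge B (I - B) (b, d) \<in> ?A"
      using d * by simp
  qed
  \<comment> \<open>The factor moves out even if the sum over \<open>?D\<close> diverges: either the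
    factor is 0 or both sums diverge, and then both sides are 0 by the convention for
    \<open>infsum\<close>.\<close>
  also have "\<dots> = c * (\<Prod>\<alpha>\<in>B. g \<alpha> (b \<alpha>)) * infsum ?G ?D"
    by (rule infsum_cmult_right')
  finally show ?thesis .
qed

text \<open>Once the part \<open>b\<close> on \<open>B\<close> is known, the event \<open>E\<close>
  says that the part on \<open>I - B\<close> has weight \<open>s - weight B v b\<close>. By the
  product form, the probability of this depends on \<open>b\<close> only through
  \<open>weight B v b\<close>, which is what \<open>dTV_law_statistic\<close> asks for. The target
  of \<open>v\<close> is an arbitrary real vector space, so that several linear conditions can be
  treated as one.\<close>

theorem dTV_conditioned_product:
  fixes v :: "'i \<Rightarrow> 'v::real_vector" and s :: 'v
  assumes "finite I" "B \<subseteq> I" "finite_measure M" and sets: "sets M = Pow (configs I)"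
    and prod: "\<And>n. n \<in> configs I \<Longrightarrow> measure M {n} = c * (\<Prod>\<alpha>\<in>I. g \<alpha> (n \<alpha>))"
  defines "E \<equiv> {n \<in> configs I. weight I v n = s}"
  assumes E: "measure M E > 0"
  shows "dTV (configs B) (cond_law (configs B) M (\<lambda>n. restrict n B) E)
           (law (configs B) M (\<lambda>n. restrict n B)) =
         dTV (range (weight B v)) (cond_law (range (weight B v)) M (weight B v) E)
           (law (range (weight B v)) M (weight B v))"
proof -
  interpret finite_measure M by fact
  have sp: "space M = configs I"
    using sets sets_eq_imp_space_eq[of _ "count_space (configs I)"] by auto
  have E0: "emeasure M E \<noteq> 0" "emeasure M E \<noteq> \<infinity>" using E by (auto simp: emeasure_eq_measure)
  let ?U = "uniform_measure M E" and ?r = "\<lambda>n. restrict n B"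
  interpret U: prob_space ?U
    using E0 by (rule prob_space_uniform_measure)
  have r: "?r \<in> measurable M (count_space (configs B))"
    by (auto simp: measurable_def sets sp configs_def)
  \<comment> \<open>\<open>infsum\<close> is \<open>0\<close> for a divergent sum, so \<open>k (\<lambda>_. True) = 0\<close> is possible; then all \<open>b\<close> have measure \<open>0\<close>.\<close>
  define k where "k Q = (\<Sum>\<^sub>\<infinity>d\<in>{d \<in> configs (I - B). Q d}. \<Prod>\<alpha>\<in>I - B. g \<alpha> (d \<alpha>))" for Q
  define F where "F b = c * (\<Prod>\<alpha>\<in>B. g \<alpha> (b \<alpha>))" for b :: "'i \<Rightarrow> nat"
  have fibre: "measure M {n \<in> configs I. restrict n B = b \<and> Q (restrict n (I - B))} = F b * k Q"
    if "b \<in> configs B" for b Q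
    unfolding F_def k_def by (rule measure_fibre[OF assms(1-5) that])
  \<comment> \<open>The quotient of the masses in \<open>\<nu>\<close> and \<open>\<mu>\<close>
    below: \<open>F b\<close> cancels, and \<open>y\<close> stands for
    \<open>weight B v b\<close>.\<close>
  define h where "h y = k (\<lambda>d. weight (I - B) v d = s - y) / k (\<lambda>_. True) / measure M E" for y
  have \<mu>: "measure (law (configs B) M ?r) {b} = F b * k (\<lambda>_. True)" if "b \<in> configs B" for b
    using that r fibre[OF that, of "\<lambda>_. True"]
    by (simp add: law_def measure_distr sp vimage_def Int_def conj_commute)
  have \<nu>: "measure (cond_law (configs B) M ?r E) {b} = F b * k (\<lambda>d. weight (I - B) v d = s - weight B v b) / measure M E"
    if b: "b \<in> configs B" for b
  proof -
    have "measure (cond_law (configs B) M ?r E) {b} = measure ?U {n \<in> configs I. restrict n B = b}"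
      using b r by (simp add: cond_law_def law_def measure_distr sp vimage_def Int_def conj_commute cong: measurable_cong_sets)
    also have "\<dots> = measure M (E \<inter> {n \<in> configs I. restrict n B = b}) / measure M E"
      using E0 by (intro measure_uniform_measure) (auto simp: sets)
    also have "E \<inter> {n \<in> configs I. restrict n B = b} =
      {n \<in> configs I. restrict n B = b \<and> weight (I - B) v (restrict n (I - B)) = s - weight B v b}"
      by (auto simp: E_def weight_split[OF assms(1,2)] algebra_simps)
    finally show ?thesis 
      unfolding fibre[OF b, of "\<lambda>d. weight (I - B) v d = s - weight B v b"] .
  qed
  have h: "measure (cond_law (configs B) M ?r E) {b} = measure (law (configs B) M ?r) {b} * h (weight B v b)"
    if b: "b \<in> configs B" for b
  proof (cases "k (\<lambda>_. True) = 0")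
    case True
    \<comment> \<open>The fibre over \<open>b\<close> cut down by the condition lies in the full
      fibre, which is a null set in this case. So both masses vanish, whatever the value of
      \<open>h\<close>.\<close>
    have "F b * k (\<lambda>d. weight (I - B) v d = s - weight B v b) \<le> F b * k (\<lambda>_. True)"
      unfolding fibre[OF b, symmetric] by (intro finite_measure_mono) (auto simp: sets)
    moreover have "F b * k (\<lambda>d. weight (I - B) v d = s - weight B v b) \<ge> 0"
      unfolding fibre[OF b, symmetric] by simp
    ultimately have "F b * k (\<lambda>d. weight (I - B) v d = s - weight B v b) = 0" using True by simp
    then show ?thesis by (simp add: \<mu> \<nu> b True)
  qed (simp add: \<mu> \<nu> b h_def)
  let ?R = "range (weight B v)"
  have im: "weight B v ` configs B = ?R"
  proof -
    have "weight B v n \<in> weight B v ` configs B" for n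
      by (rule image_eqI[of _ _ "restrict n B"]) (auto simp: configs_def)
    then show ?thesis by auto
  qed
  \<comment> \<open>\<open>weight B v\<close> ignores the coordinates outside \<open>B\<close>. This
    is needed for \<open>N\<close> equal to \<open>M\<close> and to \<open>M\<close> conditioned on
    \<open>E\<close>.\<close>
  have comp: "law ?R (law (configs B) N ?r) (weight B v) = law ?R N (weight B v)" if "sets N = sets M" for N
  proof -
    have "?r \<in> measurable N (count_space (configs B))"
      using r that by (simp cong: measurable_cong_sets)
    then show ?thesis using im by (simp add: law_def distr_distr o_def)
  qed
  have "dTV (configs B) (cond_law (configs B) M ?r E) (law (configs B) M ?r) =
    dTV ?R (law ?R (cond_law (configs B) M ?r E) (weight B v)) (law ?R (law (configs B) M ?r) (weight B v))"
  proof (rule dTV_law_statistic[where h=h])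
    show "finite_measure (law (configs B) M ?r)"
      unfolding law_def by (rule finite_measure_distr[OF r])
    show "finite_measure (cond_law (configs B) M ?r E)"
      unfolding cond_law_def law_def using r
      by (intro U.finite_measure_distr) (simp cong: measurable_cong_sets)
    show "countable (configs B)" 
      using assms(1,2) by (intro countable_configs) (auto dest: finite_subset)
  qed (use im h in \<open>auto simp: law_def cond_law_def\<close>)
  then show ?thesis by (simp add: cond_law_def comp)
qed

section \<open>Reweighting a measure by a density given up to a constant\<close>

definition normalized :: "'a measure \<Rightarrow> ('a \<Rightarrow> ennreal) \<Rightarrow> 'a measure"
  where "normalized M g = density M (\<lambda>x. g x / (\<integral>\<^sup>+x. g x \<partial>M))"

lemma sets_normalized [simp, measurable_cong]: "sets (normalized M g) = sets M"
  and space_normalized [simp]: "space (normalized M g) = space M"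
  by (simp_all add: normalized_def)

lemma uniform_measure_eq_normalized:
  "A \<in> sets M \<Longrightarrow> uniform_measure M A = normalized M (indicator A)"
  by (simp add: uniform_measure_def normalized_def)

lemma normalized_cong:
  "(\<And>x. x \<in> space M \<Longrightarrow> g x = h x) \<Longrightarrow> g \<in> borel_measurable M \<Longrightarrow> h \<in> borel_measurable M \<Longrightarrow>
    normalized M g = normalized M h"
  unfolding normalized_def
  by (subst nn_integral_cong[of M g h]) (auto intro!: density_cong)

lemma ennreal_inverse_mult_self:
  fixes c :: ennreal
  assumes "c \<noteq> 0" "c \<noteq> \<infinity>"
  shows "inverse c * c = 1"
  using ennreal_divide_self[of c] assms by (simp add: divide_ennreal_def mult.commute less_top)

lemma normalized_cmult:
  assumes [measurable]: "g \<in> borel_measurable M" and c: "c \<noteq> 0" "c \<noteq> \<infinity>"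
  shows "normalized M (\<lambda>x. c * g x) = normalized M g"
proof -
  have "c * a / (c * b) = (inverse c * c) * (a / b)" for a b :: ennreal
    using c ennreal_inverse_mult'[of b c]
    by (simp add: divide_ennreal_def less_top zero_less_iff_neq_zero ac_simps)
  then have "c * a / (c * b) = a / b" for a b :: ennreal
    using ennreal_inverse_mult_self[OF c] by simp
  then show ?thesis by (simp add: normalized_def nn_integral_cmult)
qed

text \<open>Tilting and conditioning are both reweightings, the latter by an indicator. Composing
  them multiplies the weights, so their order is irrelevant.\<close>

lemma normalized_normalized:
  assumes [measurable]: "g \<in> borel_measurable M" "h \<in> borel_measurable M"
    and "(\<integral>\<^sup>+x. g x \<partial>M) \<noteq> 0" "(\<integral>\<^sup>+x. g x \<partial>M) \<noteq> \<infinity>"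
  shows "normalized (normalized M g) h = normalized M (\<lambda>x. g x * h x)"
proof -
  have "(\<integral>\<^sup>+x. h x \<partial>normalized M g) = (\<integral>\<^sup>+x. g x * h x \<partial>M) / (\<integral>\<^sup>+x. g x \<partial>M)"
    unfolding normalized_def
    by (simp add: nn_integral_density ennreal_divide_times ennreal_times_divide nn_integral_divide mult.commute)
  \<comment> \<open>Here \<open>a\<close> is the integral of \<open>g\<close> and \<open>b\<close>
    that of \<open>g * h\<close>; \<open>a\<close> cancels because it is neither 0 nor
    infinite.\<close>
  moreover have "x / a * (y / (b / a)) = x * y / b" if "a \<noteq> 0" "a \<noteq> \<infinity>" for a b x y :: ennreal
  proof -
    have "inverse a \<noteq> 0" "inverse a \<noteq> \<infinity>"
      using that by auto
    have inv: "inverse (b * inverse a) = inverse b * inverse (inverse a)"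
      using \<open>inverse a \<noteq> 0\<close> \<open>inverse a \<noteq> \<infinity>\<close>
      by (intro ennreal_inverse_mult') (metis infinity_ennreal_def not_gr_zero top.not_eq_extremum)
    have "x / a * (y / (b / a)) = x * y * inverse b * (inverse (inverse a) * inverse a)"
      unfolding divide_ennreal_def inv by (simp only: mult_ac)
    also have "\<dots> = x * y * inverse b * 1"
      using \<open>inverse a \<noteq> 0\<close> \<open>inverse a \<noteq> \<infinity>\<close> by (subst ennreal_inverse_mult_self) auto
    finally show ?thesis by (simp add: divide_ennreal_def)
  qed
  ultimately show ?thesis
    using assms(3,4) unfolding normalized_def[of _ h]
    unfolding normalized_def
    by (simp add: density_density_eq)
qed

lemma prob_space_normalized:
  assumes [measurable]: "g \<in> borel_measurable M"
    and "(\<integral>\<^sup>+x. g x \<partial>M) \<noteq> 0" "(\<integral>\<^sup>+x. g x \<partial>M) \<noteq> \<infinity>"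
  shows "prob_space (normalized M g)"
  using assms
  by (intro prob_spaceI) (simp add: normalized_def emeasure_density nn_integral_divide ennreal_divide_self top_unique less_top cong: nn_integral_cong)

lemma measure_normalized_singleton:
  assumes "g \<in> borel_measurable M" "{x} \<in> sets M"
  shows "measure (normalized M g) {x} = enn2real (g x) * measure M {x} / enn2real (\<integral>\<^sup>+x. g x \<partial>M)"
proof -
  \<comment> \<open>This also holds at 0 and at infinity: \<open>enn2real\<close> sends infinity to
    0, and the real inverse of 0 is 0.\<close>
  have "enn2real (inverse c) = inverse (enn2real c)" for c
    by (cases c; cases "c = 0") (auto simp: inverse_ennreal ennreal_eq_0_iff not_le)
  then show ?thesis using assms
    by (simp add: measure_def normalized_def emeasure_density enn2real_mult divide_ennreal_def divide_inverse)
qed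

section \<open>Laws and conditional laws of functions of a random variable\<close>

lemma law_comp:
  assumes "X \<in> measurable M (count_space S)" "f ` S \<subseteq> R"
  shows "law R M (\<lambda>\<omega>. f (X \<omega>)) = law R (law S M X) f"
  using assms by (simp add: law_def distr_distr image_subset_iff o_def)

text \<open>Conditioning is a density by an indicator, and a density on the target of
  \<open>X\<close> pulls back along \<open>X\<close>.\<close>

lemma uniform_measure_law:
  assumes X: "X \<in> measurable M (count_space S)" and "A \<subseteq> S"
  shows "uniform_measure (law S M X) A = law S (uniform_measure M {\<omega> \<in> space M. X \<omega> \<in> A}) X"
proof -
  have "emeasure (distr M (count_space S) X) A = emeasure M {\<omega> \<in> space M. X \<omega> \<in> A}"
    using assms by (subst emeasure_distr) (auto intro!: arg_cong[where f="emeasure M"])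
  moreover have [measurable]: "{\<omega> \<in> space M. X \<omega> \<in> A} \<in> sets M" "(\<lambda>\<omega>. indicator A (X \<omega>) :: ennreal) \<in> borel_measurable M"
    using measurable_sets[OF X, of A] assms(2) measurable_compose[OF X, of "indicator A" borel]
    by (auto simp: vimage_def Int_def conj_commute)
  have "density M (\<lambda>\<omega>. indicator A (X \<omega>) / c) = density M (\<lambda>\<omega>. indicator {\<omega> \<in> space M. X \<omega> \<in> A} \<omega> / c)" for c
    by (intro density_cong) (auto split: split_indicator)
  ultimately show ?thesis using X
    unfolding law_def uniform_measure_def by (subst density_distr) auto
qed

text \<open>With \<open>X\<close> a whole family, this moves a conditional law from the sample space
  to the countable set \<open>configs I\<close>.\<close>

lemma cond_law_comp:
  assumes "X \<in> measurable M (count_space S)" "f ` S \<subseteq> R" "A \<subseteq> S"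
  shows "cond_law R M (\<lambda>\<omega>. f (X \<omega>)) {\<omega> \<in> space M. X \<omega> \<in> A} = cond_law R (law S M X) f A"
  using assms by (simp add: cond_law_def uniform_measure_law law_comp cong: measurable_cong_sets)

section \<open>Laws of families of counts and of their tilted versions\<close>

lemma PiM_count_space_configs:
  "finite I \<Longrightarrow> (\<Pi>\<^sub>M \<alpha>\<in>I. count_space UNIV) = count_space (configs I)"
  unfolding configs_def by (rule count_space_PiM_finite) auto

lemma measurable_subfamily:
  assumes "finite I" "\<And>\<alpha>. \<alpha> \<in> I \<Longrightarrow> X \<alpha> \<in> measurable M (count_space UNIV)"
  shows "subfamily I X \<in> measurable M (count_space (configs I))"
  unfolding PiM_count_space_configs[OF assms(1), symmetric] subfamily_def
  by (intro measurable_restrict assms)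

lemma measurable_subfamily_generated_field:
  assumes "finite I"
  shows "subfamily I X \<in> measurable (generated_field P I X) (count_space (configs I))"
  unfolding PiM_count_space_configs[OF assms, symmetric] generated_field_def
  by (intro measurable_vimage_algebra1) (auto simp: subfamily_def space_PiM)

lemma subalgebra_generated_field:
  assumes "finite I" "\<And>\<alpha>. \<alpha> \<in> I \<Longrightarrow> X \<alpha> \<in> measurable P (count_space UNIV)"
  shows "subalgebra P (generated_field P I X)"
proof -
  have "subfamily I X \<in> measurable P (count_space (configs I))"
    by (intro measurable_subfamily assms)
  from measurable_space[OF this] measurable_sets[OF this] show ?thesis
    by (auto simp: subalgebra_def generated_field_def PiM_count_space_configs assms(1) sets_vimage_algebra2)
qed

lemma weight_subfamily: "weight I u (subfamily I X \<omega>) = weight I u (\<lambda>\<alpha>. X \<alpha> \<omega>)"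
  unfolding subfamily_def by simp

text \<open>The tilting density is a function of the family itself, so tilting the sample space and
  then taking the law is the same as tilting the law.\<close>

lemma law_tilted:
  assumes "finite I" "\<And>\<alpha>. \<alpha> \<in> I \<Longrightarrow> X \<alpha> \<in> measurable P (count_space UNIV)"
    and "prob_space P" "\<theta> > 0"
    and int: "integrable P (\<lambda>\<omega>. \<theta> powr weight I u (subfamily I X \<omega>))"
  shows "law (configs I) (tilted P I u X \<theta>) (subfamily I X) =
    normalized (law (configs I) P (subfamily I X)) (\<lambda>n. ennreal (\<theta> powr weight I u n))"
proof -
  interpret prob_space P by fact
  let ?F = "generated_field P I X" and ?c = "\<integral>\<omega>. \<theta> powr weight I u (subfamily I X \<omega>) \<partial>P"
  have [measurable]: "subfamily I X \<in> measurable P (count_space (configs I))"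
    by (intro measurable_subfamily assms)
  have sub: "subalgebra P ?F"
    by (intro subalgebra_generated_field assms)
  have F[measurable]: "subfamily I X \<in> measurable (restr_to_subalg P ?F) (count_space (configs I))"
    by (intro measurable_in_subalg sub measurable_subfamily_generated_field assms)
  \<comment> \<open>All preimages under \<open>subfamily I X\<close> lie in the generated
    sigma-field, so restricting \<open>P\<close> to it does not affect this law.\<close>
  have law: "law (configs I) (restr_to_subalg P ?F) (subfamily I X) = law (configs I) P (subfamily I X)"
    unfolding law_def using F sub measurable_sets[OF measurable_subfamily_generated_field[OF assms(1), of X P]]
    by (intro measure_eqI) (auto simp: emeasure_distr emeasure_restr_to_subalg space_restr_to_subalg subalgebra_def)
  have c: "(\<integral>\<^sup>+n. ennreal (\<theta> powr weight I u n) \<partial>law (configs I) P (subfamily I X)) = ennreal ?c"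
    unfolding law_def using int by (simp add: nn_integral_distr nn_integral_eq_integral)
  \<comment> \<open>The integrand is strictly positive on a probability space. Positivity turns the
    quotient of extended reals in \<open>normalized\<close> into the real quotient in
    \<open>tilted\<close>.\<close>
  have "?c > 0"
    using integral_less_AE_space[of "\<lambda>_. 0" "\<lambda>\<omega>. \<theta> powr weight I u (subfamily I X \<omega>)"] int \<open>\<theta> > 0\<close>
    by (simp add: emeasure_space_1)
  then have "normalized (law (configs I) P (subfamily I X)) (\<lambda>n. ennreal (\<theta> powr weight I u n)) =
    density (law (configs I) P (subfamily I X)) (\<lambda>n. ennreal (\<theta> powr weight I u n / ?c))"
    unfolding normalized_def c by (simp add: divide_ennreal)
  also have "\<dots> = law (configs I) (tilted P I u X \<theta>) (subfamily I X)"
    unfolding law[symmetric] unfolding law_def tilted_def weight_subfamily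
    by (subst density_distr) (simp_all add: weight_subfamily)
  finally show ?thesis by simp
qed

lemma law_subfamily_singleton:
  assumes "prob_space P" "finite I" "prob_space.indep_vars P (\<lambda>_. count_space UNIV) Z I"
    and n: "n \<in> configs I"
  shows "measure (law (configs I) P (subfamily I Z)) {n} =
    (\<Prod>\<alpha>\<in>I. measure P {\<omega> \<in> space P. Z \<alpha> \<omega> = n \<alpha>})"
proof -
  interpret prob_space P by fact
  have [measurable]: "Z \<alpha> \<in> measurable P (count_space UNIV)" if "\<alpha> \<in> I" for \<alpha>
    using assms(3) that by (auto simp: indep_vars_def)
  have "subfamily I Z \<omega> = n \<longleftrightarrow> (\<forall>\<alpha>\<in>I. Z \<alpha> \<omega> = n \<alpha>)" for \<omega>
    using n by (auto simp: subfamily_def configs_def fun_eq_iff PiE_def extensional_def)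
  then have "measure (law (configs I) P (subfamily I Z)) {n} = prob {\<omega> \<in> space P. \<forall>\<alpha>\<in>I. Z \<alpha> \<omega> = n \<alpha>}"
    unfolding law_def using n
    by (subst measure_distr) (auto intro!: measurable_subfamily assms arg_cong[where f=prob])
  also have "\<dots> = (\<Prod>\<alpha>\<in>I. prob {\<omega> \<in> space P. Z \<alpha> \<omega> = n \<alpha>})"
  \<comment> \<open>The finite product rule for independent variables is stated for a nonempty index
    set; for \<open>I = {}\<close> both sides are 1.\<close>
  proof (cases "I = {}")
    case False
    then have "{\<omega> \<in> space P. \<forall>\<alpha>\<in>I. Z \<alpha> \<omega> = n \<alpha>} = (\<Inter>\<alpha>\<in>I. {\<omega> \<in> space P. Z \<alpha> \<omega> = n \<alpha>})"
      by auto
    then show ?thesis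
      using indep_varsD_finite[OF assms(3) False assms(2), of "\<lambda>\<alpha>. {n \<alpha>}"]
      by (simp add: vimage_def Int_def conj_commute)
  qed (simp add: prob_space)
  finally show ?thesis .
qed

section \<open>Conditioning, null sets and point masses of reweighted laws\<close>

lemma normalized_one: "prob_space M \<Longrightarrow> normalized M (\<lambda>_. 1) = M"
  by (simp add: normalized_def prob_space.emeasure_space_1 density_1)

lemma uniform_measure_normalized:
  assumes "g \<in> borel_measurable M" "A \<in> sets M"
    and "(\<integral>\<^sup>+x. g x \<partial>M) \<noteq> 0" "(\<integral>\<^sup>+x. g x \<partial>M) \<noteq> \<infinity>"
  shows "uniform_measure (normalized M g) A = normalized M (\<lambda>x. g x * indicator A x)"
  using assms by (simp add: uniform_measure_eq_normalized normalized_normalized)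

text \<open>The density vanishes nowhere, because \<open>g\<close> does not and its integral is
  finite. Hence events of positive probability keep it under tilting.\<close>

lemma emeasure_normalized_eq_0_iff:
  assumes "g \<in> borel_measurable M" "A \<in> sets M" "\<And>x. x \<in> space M \<Longrightarrow> g x \<noteq> 0"
    and "(\<integral>\<^sup>+x. g x \<partial>M) \<noteq> \<infinity>"
  shows "emeasure (normalized M g) A = 0 \<longleftrightarrow> emeasure M A = 0"
proof -
  have "emeasure (normalized M g) A = 0 \<longleftrightarrow> (AE x in M. x \<notin> A)"
    using assms null_sets_density_iff[of "\<lambda>x. g x / (\<integral>\<^sup>+x. g x \<partial>M)" M A]
    by (auto simp: normalized_def null_sets_def intro!: AE_cong)
  also have "\<dots> \<longleftrightarrow> emeasure M A = 0"
    using AE_iff_null_sets[OF assms(2)] assms(2) by (auto simp: null_sets_def)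
  finally show ?thesis .
qed

text \<open>A power of \<open>\<theta>\<close> with additive exponent is a product over coordinates,
  so tilting preserves the product form that comes from independence.\<close>

lemma law_subfamily_tilt_singleton:
  assumes "prob_space P" "finite I" "prob_space.indep_vars P (\<lambda>_. count_space UNIV) Z I"
    and "\<theta> > 0" and n: "n \<in> configs I"
  defines "N \<equiv> law (configs I) P (subfamily I Z)"
  shows "measure (normalized N (\<lambda>n. ennreal (\<theta> powr weight I u n))) {n} =
    inverse (enn2real (\<integral>\<^sup>+n. ennreal (\<theta> powr weight I u n) \<partial>N)) *
    (\<Prod>\<alpha>\<in>I. \<theta> powr (n \<alpha> * u \<alpha>) * measure P {\<omega> \<in> space P. Z \<alpha> \<omega> = n \<alpha>})"
proof -
  have N: "sets N = Pow (configs I)" by (simp add: N_def law_def)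
  have "measure (normalized N (\<lambda>n. ennreal (\<theta> powr weight I u n))) {n} =
    \<theta> powr weight I u n * measure N {n} / enn2real (\<integral>\<^sup>+n. ennreal (\<theta> powr weight I u n) \<partial>N)"
    using n N by (subst measure_normalized_singleton) (auto simp: measurable_def sets_eq_imp_space_eq[of N "count_space (configs I)"])
  also have "measure N {n} = (\<Prod>\<alpha>\<in>I. measure P {\<omega> \<in> space P. Z \<alpha> \<omega> = n \<alpha>})"
    unfolding N_def by (rule law_subfamily_singleton[OF assms(1-3) n])
  also have "\<theta> powr weight I u n = (\<Prod>\<alpha>\<in>I. \<theta> powr (n \<alpha> * u \<alpha>))"
    using \<open>\<theta> > 0\<close> by (simp add: weight_def powr_sum)
  finally show ?thesis by (simp add: prod.distrib divide_inverse mult_ac)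
qed

lemma measurable_subfamily_tilted:
  assumes "finite I" "\<And>\<alpha>. \<alpha> \<in> I \<Longrightarrow> X \<alpha> \<in> measurable P (count_space UNIV)"
  shows "subfamily I X \<in> measurable (tilted P I u X \<theta>) (count_space (configs I))"
proof -
  have "subfamily I X \<in> measurable (restr_to_subalg P (generated_field P I X)) (count_space (configs I))"
    by (intro measurable_in_subalg subalgebra_generated_field measurable_subfamily_generated_field assms)
  then show ?thesis by (simp add: tilted_def)
qed

section \<open>Both claims, transferred to laws on the space of configurations\<close>

theorem theorem8:
  fixes P :: "'a measure"
    and I B :: "'i set"
    and C Z :: "'i \<Rightarrow> 'a \<Rightarrow> nat"
    and w :: "'i \<Rightarrow> real ^ 'd"
    and u :: "'i \<Rightarrow> real"
    and t :: "real ^ 'd"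
    and \<theta> :: real
  defines "T \<equiv> \<lambda>\<omega>. weight I w (\<lambda>\<alpha>. Z \<alpha> \<omega>)"
    and "U \<equiv> \<lambda>\<omega>. weight I u (\<lambda>\<alpha>. C \<alpha> \<omega>)"
    and "UZ \<equiv> \<lambda>A \<omega>. weight A u (\<lambda>\<alpha>. Z \<alpha> \<omega>)"
    and "R \<equiv> \<lambda>A \<omega>. weight A w (\<lambda>\<alpha>. Z \<alpha> \<omega>)"
    and "PC \<equiv> tilted P I u C"
    and "PZ \<equiv> tilted P I u Z"
  assumes "prob_space P"
    and "finite I"
    and "\<And>\<alpha>. \<alpha> \<in> I \<Longrightarrow> C \<alpha> \<in> measurable P (count_space UNIV)"
    and "\<And>\<alpha>. \<alpha> \<in> I \<Longrightarrow> Z \<alpha> \<in> measurable P (count_space UNIV)"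
    and "prob_space.indep_vars P (\<lambda>_. count_space UNIV) Z I"
    and "measure P {\<omega> \<in> space P. T \<omega> = t} > 0"
    and "law (configs I) P (subfamily I C) =
         cond_law (configs I) P (subfamily I Z) {\<omega> \<in> space P. T \<omega> = t}"
    and "\<theta> > 0"
    and "integrable P (\<lambda>\<omega>. \<theta> powr UZ I \<omega>)"
    and "B \<subseteq> I"
  shows "dTV (configs B)
           (law (configs B) (PC \<theta>) (subfamily B C))
           (law (configs B) (PZ \<theta>) (subfamily B Z)) =
         dTV (range (weight B w))
           (cond_law (range (weight B w)) (PZ \<theta>) (R B) {\<omega> \<in> space P. T \<omega> = t})
           (law (range (weight B w)) (PZ \<theta>) (R B)) \<and>
         (\<forall>u\<^sub>0. measure P {\<omega> \<in> space P. U \<omega> = u\<^sub>0} > 0 \<longrightarrow>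
           dTV (configs B)
             (cond_law (configs B) (PC 1) (subfamily B C) {\<omega> \<in> space P. U \<omega> = u\<^sub>0})
             (law (configs B) (PZ \<theta>) (subfamily B Z)) =
           dTV (range (\<lambda>n. (weight B u n, weight B w n)))
             (cond_law (range (\<lambda>n. (weight B u n, weight B w n))) (PZ \<theta>)
                (\<lambda>\<omega>. (UZ B \<omega>, R B \<omega>)) {\<omega> \<in> space P. UZ I \<omega> = u\<^sub>0 \<and> T \<omega> = t})
             (law (range (\<lambda>n. (weight B u n, weight B w n))) (PZ \<theta>)
                (\<lambda>\<omega>. (UZ B \<omega>, R B \<omega>))))"
proof -
  note P = assms(7) and I = assms(8) and C = assms(9) and Z = assms(10) and indep = assms(11)
    and T_pos = assms(12) and C_law = assms(13) and \<theta> = assms(14) and B = assms(16)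
  interpret prob_space P by (rule P)
  \<comment> \<open>Everything takes place on \<open>configs I\<close> from here on:
    \<open>N\<close> and \<open>L\<close> are the untilted laws of \<open>Z\<close> and
    \<open>C\<close>, \<open>M\<close> is the tilted law of \<open>Z\<close>, and \<open>E\<close>
    represents the event \<open>T = t\<close>.\<close>
  define N where "N = law (configs I) P (subfamily I Z)"
  define L where "L = law (configs I) P (subfamily I C)"
  define q where "q n = ennreal (\<theta> powr weight I u n)" for n
  define M where "M = normalized N q"
  define E where "E = {n \<in> configs I. weight I w n = t}"
  have mC: "subfamily I C \<in> measurable P (count_space (configs I))"
    and mZ: "subfamily I Z \<in> measurable P (count_space (configs I))"
    using I C Z by (auto intro: measurable_subfamily)
  have mPC: "subfamily I C \<in> measurable (PC x) (count_space (configs I))"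
    and mPZ: "subfamily I Z \<in> measurable (PZ x) (count_space (configs I))" for x
    unfolding PC_def PZ_def using I C Z by (auto intro: measurable_subfamily_tilted)
  have sN: "sets N = Pow (configs I)" "space N = configs I" by (simp_all add: N_def law_def)
  have q[measurable]: "q \<in> borel_measurable N"
    by (auto simp: measurable_def sN)
  interpret N: prob_space N
    unfolding N_def law_def by (rule prob_space_distr[OF mZ])
  interpret L: prob_space L
    unfolding L_def law_def by (rule prob_space_distr[OF mC])
  have conf: "subfamily I X \<omega> \<in> configs I" for X :: "'i \<Rightarrow> 'a \<Rightarrow> nat" and \<omega>
    by (auto simp: subfamily_def configs_def)
  have int: "integrable P (\<lambda>\<omega>. \<theta> powr weight I u (subfamily I Z \<omega>))"
    using assms(15) by (simp add: weight_subfamily UZ_def)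
  have q_fin: "(\<integral>\<^sup>+n. q n \<partial>N) \<noteq> \<infinity>"
    using mZ int unfolding N_def law_def q_def
    by (simp add: nn_integral_distr nn_integral_eq_integral)
  have q_pos: "q n \<noteq> 0" for n
    using \<open>\<theta> > 0\<close> by (simp add: q_def)
  then have q_0: "(\<integral>\<^sup>+n. q n \<partial>N) \<noteq> 0"
    using N.AE_False by (simp add: nn_integral_0_iff_AE)
  have T: "{\<omega> \<in> space P. T \<omega> = t} = {\<omega> \<in> space P. subfamily I Z \<omega> \<in> E}"
    by (auto simp: T_def E_def conf weight_subfamily)
  have ES: "E \<subseteq> configs I" by (auto simp: E_def)
  have E[measurable]: "E \<in> sets N" by (auto simp: sN E_def)
  have "emeasure N E = emeasure P {\<omega> \<in> space P. T \<omega> = t}"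
    unfolding T N_def law_def
    by (subst emeasure_distr[OF mZ]) (auto simp: E_def intro!: arg_cong[where f="emeasure P"])
  with T_pos have NE: "emeasure N E \<noteq> 0" by (simp add: emeasure_eq_measure)
  have L: "L = uniform_measure N E"
    unfolding L_def C_law cond_law_def N_def T
    by (rule uniform_measure_law[symmetric]) (auto simp: mZ E_def)
  \<comment> \<open>Integrability is assumed for \<open>Z\<close> only. For \<open>C\<close> the
    expectation is that for \<open>Z\<close> restricted to \<open>E\<close>, divided by the positive
    probability of \<open>E\<close>, hence finite.\<close>
  have intC: "integrable P (\<lambda>\<omega>. \<theta> powr weight I u (subfamily I C \<omega>))"
  proof -
    have "(\<integral>\<^sup>+n. q n \<partial>L) = (\<integral>\<^sup>+n. q n * indicator E n \<partial>N) / emeasure N E"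
      unfolding L by (rule nn_integral_uniform_measure) measurable
    also have "\<dots> < \<infinity>"
    proof -
      have "(\<integral>\<^sup>+n. q n * indicator E n \<partial>N) \<le> (\<integral>\<^sup>+n. q n \<partial>N)"
        by (intro nn_integral_mono) (auto split: split_indicator)
      then show ?thesis
        using q_fin NE by (auto simp: ennreal_divide_eq_top_iff less_top[symmetric] top_unique)
    qed
    finally have "integrable L (\<lambda>n. \<theta> powr weight I u n)"
      by (intro integrableI_bounded) (auto simp: q_def L_def law_def)
    then show ?thesis
      unfolding L_def law_def using mC by (subst (asm) integrable_distr_eq) auto
  qed
  have lawZ: "law (configs I) (PZ \<theta>) (subfamily I Z) = M"
    unfolding PZ_def M_def N_def q_def using I Z P \<theta> int by (rule law_tilted)
  have iE: "(\<integral>\<^sup>+n. indicator E n \<partial>N) \<noteq> 0" "(\<integral>\<^sup>+n. indicator E n \<partial>N) \<noteq> \<infinity>"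
    using NE by auto
  have "law (configs I) (PC \<theta>) (subfamily I C) = normalized L q"
    unfolding PC_def L_def q_def using I C P \<theta> intC by (rule law_tilted)
  \<comment> \<open>Conditioning then tilting and tilting then conditioning both reweight
    \<open>N\<close> by this product.\<close>
  also have "\<dots> = normalized N (\<lambda>n. indicator E n * q n)"
    unfolding L uniform_measure_eq_normalized[OF E] by (rule normalized_normalized) (use iE in auto)
  also have "\<dots> = uniform_measure M E"
    unfolding M_def by (simp add: uniform_measure_normalized[OF q E q_0 q_fin] mult.commute)
  finally have lawC: "law (configs I) (PC \<theta>) (subfamily I C) = uniform_measure M E" .
  have lawC1: "law (configs I) (PC 1) (subfamily I C) = L"
    unfolding PC_def L_def using I C P
    by (subst law_tilted) (auto simp: L.prob_space_axioms[unfolded L_def] normalized_one)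
  interpret M: prob_space M
    unfolding M_def by (rule prob_space_normalized) (use q_0 q_fin in auto)
  have sM: "sets M = Pow (configs I)" by (simp add: M_def sN)
  have M_pos: "measure M A > 0" if "A \<subseteq> configs I" "emeasure N A \<noteq> 0" for A
    using emeasure_normalized_eq_0_iff[OF q _ q_pos q_fin, of A] that
    by (simp add: M_def[symmetric] sN M.emeasure_eq_measure zero_less_measure_iff)
  \<comment> \<open>The tilted one-coordinate weights, left unnormalized; a single constant in front
    of the product normalizes all of them at once.\<close>
  define g where "g \<alpha> k = \<theta> powr (real k * u \<alpha>) * measure P {\<omega> \<in> space P. Z \<alpha> \<omega> = k}" for \<alpha> k
  have "measure M {n} = inverse (enn2real (\<integral>\<^sup>+n. q n \<partial>N)) * (\<Prod>\<alpha>\<in>I. g \<alpha> (n \<alpha>))"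
    if "n \<in> configs I" for n
    unfolding M_def N_def q_def[abs_def] g_def
    by (rule law_subfamily_tilt_singleton[OF P I indep \<theta> that])
  \<comment> \<open>The weight and the target value stay free, since the two claims use different
    ones.\<close>
  note TV = dTV_conditioned_product[OF I B M.finite_measure_axioms sM this]
  have restr: "subfamily B X = (\<lambda>\<omega>. restrict (subfamily I X \<omega>) B)" for X :: "'i \<Rightarrow> 'a \<Rightarrow> nat"
    using B by (auto simp: subfamily_def fun_eq_iff)
  have wB: "weight B v (subfamily I X \<omega>) = weight B v (\<lambda>\<alpha>. X \<alpha> \<omega>)" for v :: "'i \<Rightarrow> 'v::real_vector" and X :: "'i \<Rightarrow> 'a \<Rightarrow> nat" and \<omega>
    using B by (auto simp: subfamily_def weight_def intro!: sum.cong)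
  have sP: "space (PC x) = space P" "space (PZ x) = space P" for x
    by (simp_all add: PC_def PZ_def)
  have im: "(\<lambda>n. restrict n B) ` configs I \<subseteq> configs B" by (auto simp: configs_def)
  have lawZB: "law (configs B) (PZ \<theta>) (subfamily B Z) = law (configs B) M (\<lambda>n. restrict n B)"
    using law_comp[OF mPZ im] by (simp add: restr lawZ)
  have part1: "dTV (configs B)
           (law (configs B) (PC \<theta>) (subfamily B C))
           (law (configs B) (PZ \<theta>) (subfamily B Z)) =
         dTV (range (weight B w))
           (cond_law (range (weight B w)) (PZ \<theta>) (R B) {\<omega> \<in> space P. T \<omega> = t})
           (law (range (weight B w)) (PZ \<theta>) (R B))"
  proof -
    have "law (configs B) (PC \<theta>) (subfamily B C) =
      cond_law (configs B) M (\<lambda>n. restrict n B) E"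
      using law_comp[OF mPC im] by (simp add: restr lawC cond_law_def)
    moreover have "cond_law (range (weight B w)) (PZ \<theta>) (R B) {\<omega> \<in> space P. T \<omega> = t} =
      cond_law (range (weight B w)) M (weight B w) E"
      using cond_law_comp[OF mPZ, of "weight B w" "range (weight B w)" E \<theta>]
      by (simp add: lawZ R_def wB T sP ES image_subset_iff)
    moreover have "law (range (weight B w)) (PZ \<theta>) (R B) = law (range (weight B w)) M (weight B w)"
      using law_comp[OF mPZ, of "weight B w" "range (weight B w)" \<theta>]
      by (simp add: lawZ R_def wB image_subset_iff)
    moreover have "measure M E > 0"
      using NE by (intro M_pos) (auto simp: E_def)
    ultimately show ?thesis
      using TV[of w t] lawZB by (simp add: E_def)
  qed
  have part2: "dTV (configs B)
             (cond_law (configs B) (PC 1) (subfamily B C) {\<omega> \<in> space P. U \<omega> = u\<^sub>0})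
             (law (configs B) (PZ \<theta>) (subfamily B Z)) =
           dTV (range (\<lambda>n. (weight B u n, weight B w n)))
             (cond_law (range (\<lambda>n. (weight B u n, weight B w n))) (PZ \<theta>)
                (\<lambda>\<omega>. (UZ B \<omega>, R B \<omega>)) {\<omega> \<in> space P. UZ I \<omega> = u\<^sub>0 \<and> T \<omega> = t})
             (law (range (\<lambda>n. (weight B u n, weight B w n))) (PZ \<theta>)
                (\<lambda>\<omega>. (UZ B \<omega>, R B \<omega>)))"
    if U_pos: "measure P {\<omega> \<in> space P. U \<omega> = u\<^sub>0} > 0" for u\<^sub>0
  proof -
    \<comment> \<open>Pairing the weights makes the two conditions on \<open>U\<close> and
      \<open>T\<close> a single one, \<open>weight I v n = (u\<^sub>0, t)\<close>.\<close>
    define v where "v \<alpha> = (u \<alpha>, w \<alpha>)" for \<alpha>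
    have v: "weight A v = (\<lambda>n. (weight A u n, weight A w n))" for A
      by (simp add: v_def weight_def fun_eq_iff prod_eq_iff fst_sum snd_sum)
    define D where "D = {n \<in> configs I. weight I u n = u\<^sub>0}"
    have DS: "D \<subseteq> configs I" by (auto simp: D_def)
    have D[measurable]: "D \<in> sets N" by (auto simp: sN D_def)
    have ED: "E \<inter> D = {n \<in> configs I. weight I v n = (u\<^sub>0, t)}"
      by (auto simp: E_def D_def v)
    have U: "{\<omega> \<in> space P. U \<omega> = u\<^sub>0} = {\<omega> \<in> space P. subfamily I C \<omega> \<in> D}"
      by (auto simp: U_def D_def conf weight_subfamily)
    have "emeasure L D = emeasure P {\<omega> \<in> space P. U \<omega> = u\<^sub>0}"
      unfolding U L_def law_def
      by (subst emeasure_distr[OF mC]) (auto simp: D_def intro!: arg_cong[where f="emeasure P"])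
    then have "emeasure L D \<noteq> 0" using U_pos by (simp add: emeasure_eq_measure)
    \<comment> \<open>\<open>L\<close> is \<open>N\<close> conditioned on \<open>E\<close>, so
      \<open>emeasure L D\<close> is a quotient with this numerator.\<close>
    then have NED: "emeasure N (E \<inter> D) \<noteq> 0"
      unfolding L by auto
    have "uniform_measure L D = normalized N (\<lambda>n. indicator E n * indicator D n)"
      unfolding L uniform_measure_eq_normalized[OF E]
      by (rule uniform_measure_normalized) (use iE in auto)
    also have "\<dots> = normalized N (indicator (E \<inter> D))"
      by (rule arg_cong[where f="normalized N"]) (auto split: split_indicator)
    \<comment> \<open>On \<open>D\<close> the tilting weight \<open>q\<close> has the constant value
      \<open>\<theta> powr u\<^sub>0\<close>. Inserting this constant is harmless after
      normalization and brings in the tilt, so the untilted and the tilted law agree once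
      conditioned.\<close>
    also have "\<dots> = normalized N (\<lambda>n. ennreal (\<theta> powr u\<^sub>0) * indicator (E \<inter> D) n)"
      using \<open>\<theta> > 0\<close> by (intro normalized_cmult[symmetric]) auto
    also have "\<dots> = normalized N (\<lambda>n. q n * indicator (E \<inter> D) n)"
    proof (rule normalized_cong)
      show "ennreal (\<theta> powr u\<^sub>0) * indicator (E \<inter> D) n = q n * indicator (E \<inter> D) n" for n
        by (cases "n \<in> D") (auto simp: q_def D_def)
    qed measurable
    also have "\<dots> = uniform_measure M (E \<inter> D)"
      unfolding M_def by (rule uniform_measure_normalized[symmetric]) (use q_0 q_fin in auto)
    finally have LD: "uniform_measure L D = uniform_measure M (E \<inter> D)" .
    have UT: "{\<omega> \<in> space P. UZ I \<omega> = u\<^sub>0 \<and> T \<omega> = t} = {\<omega> \<in> space P. subfamily I Z \<omega> \<in> E \<inter> D}"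
      by (auto simp: UZ_def T_def E_def D_def conf weight_subfamily)
    have "cond_law (configs B) (PC 1) (subfamily B C) {\<omega> \<in> space P. U \<omega> = u\<^sub>0} =
      cond_law (configs B) M (\<lambda>n. restrict n B) (E \<inter> D)"
      using cond_law_comp[OF mPC im, of D 1]
      by (simp add: restr lawC1 cond_law_def LD U sP DS)
    moreover have "cond_law (range (weight B v)) (PZ \<theta>) (\<lambda>\<omega>. (UZ B \<omega>, R B \<omega>))
        {\<omega> \<in> space P. UZ I \<omega> = u\<^sub>0 \<and> T \<omega> = t} =
      cond_law (range (weight B v)) M (weight B v) (E \<inter> D)"
      using cond_law_comp[OF mPZ, of "weight B v" "range (weight B v)" "E \<inter> D" \<theta>]
      unfolding UT by (simp add: lawZ UZ_def R_def wB sP v le_infI1 ES image_subset_iff)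
    moreover have "law (range (weight B v)) (PZ \<theta>) (\<lambda>\<omega>. (UZ B \<omega>, R B \<omega>)) =
      law (range (weight B v)) M (weight B v)"
      using law_comp[OF mPZ, of "weight B v" "range (weight B v)" \<theta>]
      by (simp add: lawZ UZ_def R_def wB v image_subset_iff)
    moreover have "measure M (E \<inter> D) > 0"
      using NED by (intro M_pos) (auto simp: E_def)
    ultimately show ?thesis
      using TV[of v "(u\<^sub>0, t)"] lawZB unfolding ED v by simp
  qed
  from part1 part2 show ?thesis by blast
qed

end
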